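(* Let $G$ be a hidden graph on vertex set $V$ accessible via a CC oracle, and let $S\subseteq V$. A maximal independent set of $G[S]$ can be computed with $\mathcal{O}(|S|)$ CC queries, and there are instances where $\Omega(|S|)$ CC queries are needed.
   Context: A CC oracle for a graph $G$ on $V$, on query $T\subseteq V$, returns the partition of $T$ into the vertex sets of the connected components of the induced subgraph $G[T]$. A maximal independent set of $G[S]$ is an independent set of $G[S]$ none of whose proper supersets within $S$ is independent. Computing it with CC queries means the procedure's output must be guaranteed (from the query answers alone) to be a maximal independent set of $G[S]$. *)

theory Defs
  imports Complex_Main
begin

text \<open>A finite simple graph on \<open>V\<close> is given by its adjacency relation \<open>E\<close>.\<close>

definition simple_graph :: "'a set \<Rightarrow> 'a rel \<Rightarrow> bool" where
  "simple_graph V E \<longleftrightarrow> finite V \<and> E \<subseteq> V \<times> V \<and> sym E \<and> irrefl E"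

definition induced_edges :: "'a rel \<Rightarrow> 'a set \<Rightarrow> 'a rel" where
  "induced_edges E T = E \<inter> T \<times> T"

text \<open>Intersecting the closure with \<open>W \<times> W\<close> only discards the reflexive pairs
  that \<open>rtrancl\<close> adds outside \<open>W\<close>.\<close>

definition components :: "'a set \<Rightarrow> 'a rel \<Rightarrow> 'a set set" where
  "components W E = W // (E\<^sup>* \<inter> W \<times> W)"

definition CC :: "'a rel \<Rightarrow> 'a set \<Rightarrow> 'a set set" where
  "CC E T = components T (induced_edges E T)"

definition independent_set :: "'a set \<Rightarrow> 'a rel \<Rightarrow> 'a set \<Rightarrow> bool" where
  "independent_set W E I \<longleftrightarrow> I \<subseteq> W \<and> (\<forall>u\<in>I. \<forall>v\<in>I. (u, v) \<notin> E)"

definition maximal_independent_set :: "'a set \<Rightarrow> 'a rel \<Rightarrow> 'a set \<Rightarrow> bool" where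
  "maximal_independent_set W E I \<longleftrightarrow>
     independent_set W E I \<and> (\<forall>J. I \<subset> J \<and> J \<subseteq> W \<longrightarrow> \<not> independent_set W E J)"

text \<open>Adaptive query procedures are decision trees: after asking a query the procedure
  continues depending on the answer only, so it has no other access to the hidden graph.\<close>

datatype 'a procedure =
    Output "'a set"
  | Query "'a set" "'a set set \<Rightarrow> 'a procedure"

primrec run_output :: "('a set \<Rightarrow> 'a set set) \<Rightarrow> 'a procedure \<Rightarrow> 'a set" where
  "run_output oracle_fn (Output I) = I"
| "run_output oracle_fn (Query T k) = run_output oracle_fn (k (oracle_fn T))"

primrec run_queries :: "('a set \<Rightarrow> 'a set set) \<Rightarrow> 'a procedure \<Rightarrow> 'a set list" where
  "run_queries oracle_fn (Output I) = []"
| "run_queries oracle_fn (Query T k) = T # run_queries oracle_fn (k (oracle_fn T))"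

text \<open>On the hidden graph \<open>(V, E)\<close>, the output must be correct for every graph \<open>(V, H)\<close>
  that is consistent with all answers received during the run.\<close>

definition computes_mis :: "'a set \<Rightarrow> 'a set \<Rightarrow> 'a rel \<Rightarrow> 'a procedure \<Rightarrow> bool" where
  "computes_mis V S E P \<longleftrightarrow>
     (\<forall>T\<in>set (run_queries (CC E) P). T \<subseteq> V) \<and>
     (\<forall>H. simple_graph V H \<and> (\<forall>T\<in>set (run_queries (CC E) P). CC H T = CC E T)
        \<longrightarrow> maximal_independent_set S (induced_edges H S) (run_output (CC E) P))"

end

theory Submission
  imports Defs
begin

text \<open>
  Upper bound: run the greedy algorithm; a vertex \<open>v\<close> can be added to the current set \<open>I\<close> iff
  it is a singleton component of the query \<open>insert v I\<close>. Lower bound: in a complete graph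
  the output is a single vertex \<open>v\<close>, and deleting the edge \<open>uv\<close> changes only the answer to the
  query \<open>{u, v}\<close>, so that query must have been asked for every \<open>u \<noteq> v\<close>.
\<close>

text \<open>A procedure sees the graph only through the answers, so equal answers along the run of
  \<open>f\<close> keep \<open>g\<close> on the same branch of the decision tree.\<close>

lemma run_output_cong:
  assumes "\<forall>T\<in>set (run_queries f P). g T = f T"
  shows "run_output g P = run_output f P"
  using assms by (induction P) auto

lemma singleton_in_CC_iff:
  assumes "irrefl H" "v \<in> T"
  shows "{v} \<in> CC H T \<longleftrightarrow> (\<forall>u\<in>T. (v, u) \<notin> H)"
proof -
  let ?D = "induced_edges H T"
  let ?R = "?D\<^sup>* \<inter> T \<times> T"
  have "{v} \<in> CC H T \<longleftrightarrow> ?R `` {v} = {v}"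
  proof
    assume "{v} \<in> CC H T"
    then obtain x where x: "{v} = ?R `` {x}" "x \<in> T"
      unfolding CC_def components_def by (elim quotientE)
    from x(2) have "x \<in> ?R `` {x}" by simp
    then have "x = v" unfolding x(1)[symmetric] by simp
    then show "?R `` {v} = {v}" using x(1) by metis
  next
    assume "?R `` {v} = {v}"
    with quotientI[OF assms(2), of ?R] show "{v} \<in> CC H T"
      unfolding CC_def components_def by simp
  qed
  also have "\<dots> \<longleftrightarrow> (\<forall>u\<in>T. (v, u) \<notin> H)"
  proof
    assume R: "?R `` {v} = {v}"
    show "\<forall>u\<in>T. (v, u) \<notin> H"
    proof (intro ballI notI)
      fix u assume u: "u \<in> T" "(v, u) \<in> H"
      with assms(2) have "(v, u) \<in> ?D" by (simp add: induced_edges_def)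
      with assms(2) u(1) have "u \<in> ?R `` {v}" by blast
      with R u(2) assms(1) show False by (auto simp: irrefl_def)
    qed
  next
    assume no_edge: "\<forall>u\<in>T. (v, u) \<notin> H"
    \<comment> \<open>A nontrivial path leaving \<open>v\<close> would start with an edge from
      \<open>v\<close> to a vertex of \<open>T\<close>.\<close>
    have "u = v" if "(v, u) \<in> ?D\<^sup>*" for u
      using that
    proof (cases rule: converse_rtranclE)
      case (step y)
      with no_edge show ?thesis by (auto simp: induced_edges_def)
    qed simp
    with assms(2) show "?R `` {v} = {v}" by auto
  qed
  finally show ?thesis .
qed

text \<open>Replaces the quantification over supersets by domination: an undominated
  \<open>w\<close> could be added to \<open>I\<close> alone, and conversely any larger independent
  set contains a vertex outside \<open>I\<close> without neighbours in \<open>I\<close>.\<close>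

lemma maximal_independent_set_iff:
  assumes "sym H" "irrefl H"
  shows "maximal_independent_set S (induced_edges H S) I \<longleftrightarrow>
    I \<subseteq> S \<and> (\<forall>u\<in>I. \<forall>w\<in>I. (u, w) \<notin> H) \<and> (\<forall>w\<in>S - I. \<exists>u\<in>I. (w, u) \<in> H)"
proof -
  have indep: "independent_set S (induced_edges H S) J \<longleftrightarrow>
      J \<subseteq> S \<and> (\<forall>u\<in>J. \<forall>w\<in>J. (u, w) \<notin> H)" for J
    by (auto simp: independent_set_def induced_edges_def)
  have "\<exists>u\<in>I. (w, u) \<in> H"
    if max: "maximal_independent_set S (induced_edges H S) I" and w: "w \<in> S - I" for w
  proof (rule ccontr)
    assume "\<not> ?thesis"
    with max w assms have "independent_set S (induced_edges H S) (insert w I)"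
      unfolding maximal_independent_set_def indep by (auto dest: symD simp: irrefl_def)
    moreover have "I \<subset> insert w I" "insert w I \<subseteq> S"
      using max w unfolding maximal_independent_set_def indep by auto
    ultimately show False
      using max unfolding maximal_independent_set_def by blast
  qed
  then show ?thesis
    unfolding maximal_independent_set_def indep by blast
qed

text \<open>\<open>I\<close> accumulates the accepted vertices. Each list entry costs exactly one
  query, whatever the answers are.\<close>

primrec greedy :: "'a list \<Rightarrow> 'a set \<Rightarrow> 'a procedure" where
  "greedy [] I = Output I"
| "greedy (v # vs) I =
     Query (insert v I) (\<lambda>A. greedy vs (if {v} \<in> A then insert v I else I))"

lemma length_run_queries_greedy: "length (run_queries f (greedy vs I)) = length vs"
  by (induction vs arbitrary: I) auto

lemma run_queries_greedy_subset:
  "T \<in> set (run_queries f (greedy vs I)) \<Longrightarrow> T \<subseteq> I \<union> set vs"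
proof (induction vs arbitrary: I)
  case (Cons v vs)
  show ?case
  proof (cases "T = insert v I")
    case False
    with Cons.prems
    have "T \<in> set (run_queries f (greedy vs (if {v} \<in> f (insert v I) then insert v I else I)))"
      by simp
    from Cons.IH[OF this] show ?thesis by (auto split: if_splits)
  qed auto
qed simp

text \<open>The loop invariant, for an arbitrary independent start \<open>I\<close>. The part
  \<open>I \<subseteq> J\<close> matters in the induction: the neighbour that caused a vertex to be
  rejected is never removed later.\<close>

lemma run_output_greedy:
  fixes vs :: "'a list"
  assumes "sym H" "irrefl H" "\<forall>u\<in>I. \<forall>w\<in>I. (u, w) \<notin> H"
  defines "J \<equiv> run_output (CC H) (greedy vs I)"
  shows "I \<subseteq> J \<and> J \<subseteq> I \<union> set vs \<and> (\<forall>u\<in>J. \<forall>w\<in>J. (u, w) \<notin> H) \<and>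
    (\<forall>w\<in>set vs - J. \<exists>u\<in>J. (w, u) \<in> H)"
  using assms(3) unfolding J_def
proof (induction vs arbitrary: I)
  case Nil
  then show ?case by simp
next
  case (Cons v vs)
  have free: "{v} \<in> CC H (insert v I) \<longleftrightarrow> (\<forall>u\<in>insert v I. (v, u) \<notin> H)"
    by (rule singleton_in_CC_iff[OF assms(2) insertI1])
  show ?case
  proof (cases "{v} \<in> CC H (insert v I)")
    case True
    with Cons.prems free assms(1) have "\<forall>u\<in>insert v I. \<forall>w\<in>insert v I. (u, w) \<notin> H"
      by (auto dest: symD)
    from Cons.IH[OF this] True show ?thesis by auto
  next
    case False
    \<comment> \<open>Irreflexivity excludes \<open>v\<close> itself, so the neighbour found in
      \<open>insert v I\<close> lies in \<open>I\<close>.\<close>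
    with free assms(2) obtain u where "u \<in> I" "(v, u) \<in> H"
      by (auto simp: irrefl_def)
    with Cons.IH[OF Cons.prems] False show ?thesis by auto
  qed
qed

lemma computes_mis_greedy:
  assumes "S \<subseteq> V" "set vs = S"
  shows "computes_mis V S E (greedy vs {})"
  unfolding computes_mis_def
proof (intro conjI ballI allI impI)
  show "T \<subseteq> V" if "T \<in> set (run_queries (CC E) (greedy vs {}))" for T
    using run_queries_greedy_subset[OF that] assms by blast
next
  fix H
  assume H: "simple_graph V H \<and>
    (\<forall>T\<in>set (run_queries (CC E) (greedy vs {})). CC H T = CC E T)"
  then have "sym H" "irrefl H" by (auto simp: simple_graph_def)
  \<comment> \<open>The run on \<open>E\<close> is also the run on \<open>H\<close>, so correctness
    of the greedy run on \<open>H\<close> applies to the output obtained on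
    \<open>E\<close>.\<close>
  moreover have "run_output (CC E) (greedy vs {}) = run_output (CC H) (greedy vs {})"
    using H run_output_cong by metis
  ultimately show "maximal_independent_set S (induced_edges H S)
      (run_output (CC E) (greedy vs {}))"
    using run_output_greedy[of H "{}" vs] assms(2)
    by (auto simp: maximal_independent_set_iff)
qed

text \<open>A query missing \<open>u\<close> or \<open>v\<close> cannot see the edge. A query
  containing both has a third vertex, through which \<open>u\<close> and \<open>v\<close> stay
  connected.\<close>

lemma CC_complete_minus_edge:
  assumes "T \<subseteq> V" "T \<noteq> {u, v}"
  shows "CC (V \<times> V - Id - {(u, v), (v, u)}) T = CC (V \<times> V - Id) T"
proof (cases "{u, v} \<subseteq> T")
  case False
  then have "induced_edges (V \<times> V - Id - {(u, v), (v, u)}) T = induced_edges (V \<times> V - Id) T"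
    by (auto simp: induced_edges_def)
  then show ?thesis by (simp add: CC_def)
next
  case True
  with assms(2) obtain w where w: "w \<in> T" "w \<noteq> u" "w \<noteq> v" by blast
  let ?H = "induced_edges (V \<times> V - Id - {(u, v), (v, u)}) T"
  let ?E = "induced_edges (V \<times> V - Id) T"
  have "(x, y) \<in> ?H\<^sup>*" if "x \<in> T" "y \<in> T" for x y
  proof (cases "x = y \<or> (x, y) \<in> ?H")
    case True
    then show ?thesis by auto
  next
    case False
    \<comment> \<open>Here \<open>x\<close> and \<open>y\<close> are \<open>u\<close> and
      \<open>v\<close> in some order, so the detour through \<open>w\<close> uses no deleted
      edge.\<close>
    with that assms(1) w have "(x, w) \<in> ?H" "(w, y) \<in> ?H"
      by (auto simp: induced_edges_def)
    then show ?thesis by (meson r_into_rtrancl rtrancl_trans)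
  qed
  moreover have "?H\<^sup>* \<subseteq> ?E\<^sup>*"
    by (rule rtrancl_mono) (auto simp: induced_edges_def)
  ultimately have "?H\<^sup>* \<inter> T \<times> T = ?E\<^sup>* \<inter> T \<times> T" by blast
  then show ?thesis by (simp add: CC_def components_def)
qed

lemma simple_graph_complete: "finite V \<Longrightarrow> simple_graph V (V \<times> V - Id)"
  by (auto simp: simple_graph_def sym_def irrefl_def)

lemma simple_graph_delete_edge:
  "simple_graph V E \<Longrightarrow> simple_graph V (E - {(u, v), (v, u)})"
  by (auto simp: simple_graph_def sym_def irrefl_def)

lemma complete_graph_queries:
  assumes "finite V" "computes_mis V V (V \<times> V - Id) P"
  shows "card V \<le> Suc (length (run_queries (CC (V \<times> V - Id)) P))"
proof (cases "V = {}")
  case False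
  let ?E = "V \<times> V - Id"
  let ?Q = "run_queries (CC ?E) P"
  let ?I = "run_output (CC ?E) P"
  \<comment> \<open>The single output \<open>?I\<close> must suit every consistent \<open>H\<close>;
    this is used for the complete graph and for the graph with one edge deleted.\<close>
  have mis: "?I \<subseteq> V \<and> (\<forall>u\<in>?I. \<forall>w\<in>?I. (u, w) \<notin> H) \<and> (\<forall>w\<in>V - ?I. \<exists>u\<in>?I. (w, u) \<in> H)"
    if "simple_graph V H" "\<forall>T\<in>set ?Q. CC H T = CC ?E T" for H
  proof -
    have "sym H" "irrefl H"
      using that(1) by (auto simp: simple_graph_def)
    moreover have "maximal_independent_set V (induced_edges H V) ?I"
      using assms(2) that unfolding computes_mis_def by blast
    ultimately show ?thesis
      by (rule maximal_independent_set_iff[THEN iffD1])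
  qed
  note mis_E = mis[OF simple_graph_complete[OF assms(1)] ballI[OF refl]]
  \<comment> \<open>An empty output would leave the vertices of the nonempty \<open>V\<close>
    undominated.\<close>
  with False obtain v where v: "v \<in> ?I" by blast
  with mis_E have I: "?I = {v}" "v \<in> V" by blast+
  have "{u, v} \<in> set ?Q" if u: "u \<in> V - {v}" for u
  proof (rule ccontr)
    assume no_query: "{u, v} \<notin> set ?Q"
    let ?H = "?E - {(u, v), (v, u)}"
    have "\<forall>T\<in>set ?Q. T \<subseteq> V"
      using assms(2) by (simp add: computes_mis_def)
    with no_query have "\<forall>T\<in>set ?Q. CC ?H T = CC ?E T"
      using CC_complete_minus_edge by metis
    \<comment> \<open>After the deletion, \<open>u\<close> has no neighbour in \<open>{v}\<close>,
      so \<open>{v}\<close> is no longer maximal.\<close>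
    from mis[OF simple_graph_delete_edge[OF simple_graph_complete[OF assms(1)]] this]
    show False using u I(1) by auto
  qed
  then have "(\<lambda>u. {u, v}) ` (V - {v}) \<subseteq> set ?Q" by blast
  moreover have "inj_on (\<lambda>u. {u, v}) (V - {v})"
    by (auto simp: inj_on_def doubleton_eq_iff)
  ultimately have "card (V - {v}) \<le> card (set ?Q)"
    using card_inj_on_le by blast
  then have "card (V - {v}) \<le> length ?Q"
    using card_length le_trans by blast
  with assms(1) I(2) show ?thesis by simp
qed simp

theorem theorem15:
  shows "(\<exists>C::nat. \<forall>(V::'a set) S. finite V \<and> S \<subseteq> V \<longrightarrow>
            (\<exists>P. \<forall>E. simple_graph V E \<longrightarrow>
               computes_mis V S E P \<and> length (run_queries (CC E) P) \<le> C * card S))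
       \<and> (\<exists>c::real. c > 0 \<and> (\<exists>n0::nat. \<forall>n\<ge>n0. \<exists>(V::nat set) S E.
            simple_graph V E \<and> S \<subseteq> V \<and> card S = n \<and>
            (\<forall>P. computes_mis V S E P \<longrightarrow>
               c * real n \<le> real (length (run_queries (CC E) P)))))"
proof
  show "\<exists>C::nat. \<forall>(V::'a set) S. finite V \<and> S \<subseteq> V \<longrightarrow>
            (\<exists>P. \<forall>E. simple_graph V E \<longrightarrow>
               computes_mis V S E P \<and> length (run_queries (CC E) P) \<le> C * card S)"
  \<comment> \<open>\<open>C = 1\<close> since \<open>vs\<close> lists \<open>S\<close> without
    repetition; the procedure depends on \<open>S\<close> only, not on \<open>E\<close>.\<close>
  proof (rule exI[of _ 1], intro allI impI)
    fix V S :: "'a set"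
    assume S: "finite V \<and> S \<subseteq> V"
    then obtain vs where vs: "set vs = S" "distinct vs"
      using finite_distinct_list finite_subset by metis
    with S have "computes_mis V S E (greedy vs {}) \<and>
        length (run_queries (CC E) (greedy vs {})) \<le> 1 * card S" for E
      using computes_mis_greedy[of S V vs] distinct_card[OF vs(2)]
      by (simp add: length_run_queries_greedy)
    then show "\<exists>P. \<forall>E. simple_graph V E \<longrightarrow>
        computes_mis V S E P \<and> length (run_queries (CC E) P) \<le> 1 * card S"
      by blast
  qed
next
  \<comment> \<open>The complete graph forces \<open>n - 1\<close> queries, which is at least
    \<open>n / 2\<close> once \<open>n \<ge> 2\<close>; hence the constant and the
    threshold.\<close>
  have "1 / 2 * real n \<le> real (length (run_queries (CC ({..<n} \<times> {..<n} - Id)) P))"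
    if "n \<ge> 2" "computes_mis {..<n} {..<n} ({..<n} \<times> {..<n} - Id) P" for n P
    using complete_graph_queries[OF _ that(2)] that(1) by simp
  then have "\<forall>n\<ge>2. \<exists>(V::nat set) S E.
      simple_graph V E \<and> S \<subseteq> V \<and> card S = n \<and>
      (\<forall>P. computes_mis V S E P \<longrightarrow>
         1 / 2 * real n \<le> real (length (run_queries (CC E) P)))"
    by (intro allI impI exI[of _ "{..<_}"] exI[of _ "{..<_} \<times> {..<_} - Id"] conjI)
      (auto simp: simple_graph_complete)
  then show "\<exists>c::real. c > 0 \<and> (\<exists>n0::nat. \<forall>n\<ge>n0. \<exists>(V::nat set) S E.
            simple_graph V E \<and> S \<subseteq> V \<and> card S = n \<and>
            (\<forall>P. computes_mis V S E P \<longrightarrow>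
               c * real n \<le> real (length (run_queries (CC E) P))))"
    by (intro exI[of _ "1 / 2 :: real"] conjI exI[of _ "2 :: nat"]) auto
qed

end
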